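(* Let $M$ be an $n\times n$ invertible complex matrix. (i) For almost every $n\times n$ complex diagonal matrix $D$, the matrix $MD$ has distinct eigenvalues. (ii) For almost every $n\times n$ diagonal unitary matrix $\Omega$, the matrix $M\Omega$ has distinct eigenvalues.
   Context: An $n\times n$ matrix has distinct eigenvalues if its characteristic polynomial has $n$ distinct roots. In (i), diagonal matrices $D=\mathrm{diag}(d_1,\dots,d_n)$ are identified with points $(d_1,\dots,d_n)\in\mathbb{C}^n$ and "almost every" refers to Lebesgue measure on $\mathbb{C}^n$. In (ii), diagonal unitary matrices $\Omega=\mathrm{diag}(\omega_1,\dots,\omega_n)$ are identified with points $(\omega_1,\dots,\omega_n)\in\mathbb{T}^n$, where $\mathbb{T}$ is the unit circle, and "almost every" refers to the product (Haar/Lebesgue) measure on $\mathbb{T}^n$. *)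

theory Defs
  imports
    "HOL-Probability.Probability"
    "Jordan_Normal_Form.Char_Poly"
begin

definition distinct_eigenvalues :: "complex mat \<Rightarrow> bool" where
  "distinct_eigenvalues A \<longleftrightarrow> card {z. poly (char_poly A) z = 0} = dim_row A"

(* AE does not distinguish a measure from its completion, so the product of the Borel versions of
   Lebesgue measure has the same null sets as Lebesgue measure on C^n. Points of C^n are
   functions on {..<n}, extensional in the sense of PiE. *)
definition lebesgue_Cn :: "nat \<Rightarrow> (nat \<Rightarrow> complex) measure" where
  "lebesgue_Cn n = PiM {..<n} (\<lambda>_. lborel)"

(* Normalised arc length (Haar probability measure), living on the unit circle itself, so that
   the space of the product measure below is the torus. *)
definition circle_measure :: "complex measure" where
  "circle_measure =
     distr (uniform_measure lborel {0..<2 * pi}) (restrict_space borel (sphere 0 1)) cis"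

definition torus_measure :: "nat \<Rightarrow> (nat \<Rightarrow> complex) measure" where
  "torus_measure n = PiM {..<n} (\<lambda>_. circle_measure)"

lemma space_circle_measure: "space circle_measure = sphere 0 1"
  by (simp add: circle_measure_def space_restrict_space)

lemma cis_measurable_circle:
  "cis \<in> measurable (uniform_measure lborel {0..<2 * pi}) (restrict_space borel (sphere 0 1))"
proof (rule measurable_restrict_space2)
  have "cis \<in> borel_measurable borel"
    by (intro borel_measurable_continuous_onI continuous_intros)
  then show "cis \<in> borel_measurable (uniform_measure lborel {0..<2 * pi})"
    by (simp cong: measurable_cong_sets)
qed (auto simp: dist_norm)

lemma prob_space_circle_measure: "prob_space circle_measure"
  unfolding circle_measure_def
  by (intro prob_space.prob_space_distr prob_space_uniform_measure cis_measurable_circle) auto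

lemma space_torus_measure: "space (torus_measure n) = {..<n} \<rightarrow>\<^sub>E sphere 0 1"
  by (simp add: torus_measure_def space_PiM space_circle_measure)

end

theory Submission
  imports Defs
begin

text \<open>
  The polynomial \<open>G(d) = det (1 - x M diag(d))\<close> in \<open>x\<close> is affine in each \<open>d\<^sub>k\<close>, and \<open>G(0) = 1\<close>
  has no multiple root. If \<open>A\<close> has no multiple root, then neither has \<open>A + s B\<close> for all but finitely
  many \<open>s\<close>: a multiple root of \<open>A + s B\<close> is a root of the Wronskian \<open>A B' - A' B\<close>, and each root
  of the latter excludes at most one \<open>s\<close>, unless the Wronskian vanishes and \<open>B\<close> is a scalar multiple
  of \<open>A\<close>. Switching on the coordinates \<open>d\<^sub>k\<close> one at a time, Fubini's theorem shows that \<open>G(d)\<close> has no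
  multiple root for almost every \<open>d\<close>, for any product of measures without atoms. Since
  \<open>det (M diag(d)) \<noteq> 0\<close> for almost every \<open>d\<close>, the roots of \<open>G(d)\<close> are the inverses of the
  eigenvalues, and there are \<open>n\<close> of them.
\<close>

section \<open>Multiple roots in pencils of polynomials\<close>

text \<open>Subtract from \<open>B\<close> the multiple of \<open>A\<close> that makes the
  difference \<open>h\<close> vanish at a point \<open>x\<close> with \<open>A(x)\<close> nonzero.
  The relation \<open>A h' = A' h\<close> survives, but for nonzero \<open>h\<close> the order of
  \<open>x\<close> on the left is one less than its order in \<open>h\<close>, and on the right at
  least that order.\<close>

lemma proportional_if_wronskian_eq_0:
  fixes A B :: "'a::field_char_0 poly"
  assumes "A \<noteq> 0" and W: "A * pderiv B = pderiv A * B"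
  obtains c where "B = Polynomial.smult c A"
proof -
  have "finite {x. poly A x = 0}"
    using \<open>A \<noteq> 0\<close> by (rule poly_roots_finite)
  then obtain x where x: "poly A x \<noteq> 0"
    using ex_new_if_finite[OF infinite_UNIV_char_0] by blast
  define c where "c = poly B x / poly A x"
  define h where "h = B - Polynomial.smult c A"
  have "h = 0"
  proof (rule ccontr)
    assume "h \<noteq> 0"
    have hx: "poly h x = 0"
      using x by (simp add: h_def c_def)
    have Wh: "A * pderiv h = pderiv A * h"
      using W by (simp add: h_def pderiv_diff pderiv_smult algebra_simps)
    have "pderiv h \<noteq> 0"
    proof
      assume "pderiv h = 0"
      then obtain a where "h = [:a:]" using pderiv_iszero by blast
      with hx \<open>h \<noteq> 0\<close> show False by simp
    qed
    then have "Polynomial.order x h = Suc (Polynomial.order x (pderiv h))"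
      using hx \<open>h \<noteq> 0\<close> by (intro order_pderiv) (auto simp: order_root)
    moreover have "Polynomial.order x (A * pderiv h) = Polynomial.order x (pderiv h)"
      using \<open>A \<noteq> 0\<close> \<open>pderiv h \<noteq> 0\<close> x by (simp add: order_mult order_0I)
    moreover have "Polynomial.order x (A * pderiv h) \<ge> Polynomial.order x h"
    proof -
      have "pderiv A * h \<noteq> 0"
        using \<open>A \<noteq> 0\<close> \<open>pderiv h \<noteq> 0\<close> by (simp flip: Wh)
      then show ?thesis by (simp add: Wh order_mult)
    qed
    ultimately show False by simp
  qed
  then show thesis by (intro that[of c]) (simp add: h_def)
qed

lemma finite_not_rsquarefree_pencil:
  fixes A B :: "'a::field_char_0 poly"
  assumes sf: "rsquarefree A"
  shows "finite {s. \<not> rsquarefree (A + Polynomial.smult s B)}"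
proof (cases "A * pderiv B = pderiv A * B")
  case True
  have "A \<noteq> 0" using sf by (simp add: rsquarefree_def)
  then obtain c where B: "B = Polynomial.smult c A"
    using True proportional_if_wronskian_eq_0 by blast
  have "1 + s * c = 0" if "\<not> rsquarefree (A + Polynomial.smult s B)" for s
  proof (rule ccontr)
    assume nz: "1 + s * c \<noteq> 0"
    have "A + Polynomial.smult s B = Polynomial.smult (1 + s * c) A"
      by (simp add: B smult_add_left)
    then have "rsquarefree (A + Polynomial.smult s B)"
      using nz sf by (auto simp: rsquarefree_roots pderiv_smult)
    with that show False by simp
  qed
  moreover have "s = - 1 / c" if "1 + s * c = 0" for s
    using that by (cases "c = 0") (simp_all add: field_simps eq_neg_iff_add_eq_0)
  ultimately have "{s. \<not> rsquarefree (A + Polynomial.smult s B)} \<subseteq> {- 1 / c}"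
    by blast
  then show ?thesis by (rule finite_subset) simp
next
  case False
  define X where "X = {x. poly (A * pderiv B - pderiv A * B) x = 0}"
  define S where "S x = {s. poly (A + Polynomial.smult s B) x = 0 \<and> poly (pderiv (A + Polynomial.smult s B)) x = 0}" for x
  have "finite X"
    unfolding X_def using False by (intro poly_roots_finite) auto
  have "finite (S x)" for x
  proof -
    \<comment> \<open>If both vanished, \<open>x\<close> would be a multiple root of
      \<open>A\<close> itself. So at least one of the two equations defining \<open>S x\<close> can
      be solved for \<open>s\<close>.\<close>
    have "poly B x \<noteq> 0 \<or> poly (pderiv B) x \<noteq> 0" if "s \<in> S x" for s
      using that sf by (auto simp: S_def rsquarefree_roots pderiv_add pderiv_smult)
    moreover have "s = - poly A x / poly B x" if "s \<in> S x" "poly B x \<noteq> 0" for s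
      using that by (auto simp: S_def field_simps eq_neg_iff_add_eq_0 add.commute)
    moreover have "s = - poly (pderiv A) x / poly (pderiv B) x"
      if "s \<in> S x" "poly (pderiv B) x \<noteq> 0" for s
      using that by (auto simp: S_def field_simps eq_neg_iff_add_eq_0 add.commute pderiv_add pderiv_smult)
    ultimately have "S x \<subseteq> {- poly A x / poly B x, - poly (pderiv A) x / poly (pderiv B) x}"
      by blast
    then show ?thesis by (rule finite_subset) simp
  qed
  with \<open>finite X\<close> have "finite (\<Union>x\<in>X. S x)" by blast
  moreover have "{s. \<not> rsquarefree (A + Polynomial.smult s B)} \<subseteq> (\<Union>x\<in>X. S x)"
  proof
    fix s assume "s \<in> {s. \<not> rsquarefree (A + Polynomial.smult s B)}"
    then obtain x where x: "poly (A + Polynomial.smult s B) x = 0" "poly (pderiv (A + Polynomial.smult s B)) x = 0"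
      by (auto simp: rsquarefree_roots)
    \<comment> \<open>The Wronskian with \<open>B\<close> does not change when a multiple of
      \<open>B\<close> is added to \<open>A\<close>, so it vanishes at each multiple root of the
      pencil member.\<close>
    have "A * pderiv B - pderiv A * B =
        (A + Polynomial.smult s B) * pderiv B - pderiv (A + Polynomial.smult s B) * B"
      by (simp add: pderiv_add pderiv_smult algebra_simps)
    then have "x \<in> X"
      unfolding X_def using x by (simp del: poly_add)
    with x show "s \<in> (\<Union>x\<in>X. S x)" by (auto simp: S_def)
  qed
  ultimately show ?thesis by (rule rev_finite_subset)
qed

lemma card_roots_rsquarefree:
  fixes p :: "complex poly"
  assumes "rsquarefree p"
  shows "card {z. poly p z = 0} = Polynomial.degree p"
proof -
  have "p \<noteq> 0" using assms by (simp add: rsquarefree_def)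
  have "Polynomial.degree p = Polynomial.degree (Polynomial.smult (lead_coeff p) (\<Prod>z|poly p z = 0. [:-z, 1:]))"
    by (simp only: complex_poly_decompose_rsquarefree[OF assms])
  also have "\<dots> = card {z. poly p z = 0}"
    using \<open>p \<noteq> 0\<close> by (simp add: degree_prod_eq_sum_degree)
  finally show ?thesis by simp
qed

section \<open>Measurability, and Fubini one coordinate at a time\<close>

text \<open>By compactness, two continuous functions have a common zero in a ball iff they are
  simultaneously arbitrarily small at points of a countable dense set.\<close>
lemma pred_rsquarefree:
  fixes F :: "'a \<Rightarrow> complex poly"
  assumes [measurable]: "\<And>x. (\<lambda>d. poly (F d) x) \<in> borel_measurable N"
  shows "Measurable.pred N (\<lambda>d. rsquarefree (F d))"
proof -
  \<comment> \<open>The derivative is a pointwise limit of difference quotients with increments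
    1/(i+1), which are measurable in \<open>d\<close>.\<close>
  have [measurable]: "(\<lambda>d. poly (pderiv (F d)) x) \<in> borel_measurable N" for x
  proof (rule borel_measurable_LIMSEQ_metric)
    show "(\<lambda>d. (poly (F d) (x + of_real (inverse (real (Suc i)))) - poly (F d) x) /
        of_real (inverse (real (Suc i)))) \<in> borel_measurable N" for i
      by measurable
    fix d
    have "((\<lambda>h. (poly (F d) (x + h) - poly (F d) x) / h) \<longlongrightarrow> poly (pderiv (F d)) x) (at 0)"
      using poly_DERIV[of "F d" x] by (simp add: DERIV_def)
    moreover have "filterlim (\<lambda>i. of_real (inverse (real (Suc i))) :: complex) (at 0) sequentially"
      unfolding filterlim_at
      using tendsto_of_real[OF LIMSEQ_inverse_real_of_nat, where 'a = complex]
      by (simp del: of_nat_Suc)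
    ultimately show "(\<lambda>i. (poly (F d) (x + of_real (inverse (real (Suc i)))) - poly (F d) x) /
        of_real (inverse (real (Suc i)))) \<longlonglongrightarrow> poly (pderiv (F d)) x"
      by (rule filterlim_compose)
  qed
  define g where "g d x = norm (poly (F d) x) + norm (poly (pderiv (F d)) x)" for d x
  have [measurable]: "(\<lambda>d. g d x) \<in> borel_measurable N" for x
    unfolding g_def by measurable
  have cont: "continuous_on UNIV (g d)" for d
    unfolding g_def by (intro continuous_intros)
  obtain D :: "complex set" where D: "countable D"
    and dense: "\<And>X. open X \<Longrightarrow> X \<noteq> {} \<Longrightarrow> \<exists>x\<in>D. x \<in> X"
    using countable_dense_setE by blast
  have "\<not> rsquarefree (F d) \<longleftrightarrow>
      (\<exists>R::nat. \<forall>k::nat. \<exists>x\<in>D. norm x < real R \<and> g d x < inverse (real (Suc k)))" for d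
  proof
    assume "\<not> rsquarefree (F d)"
    then obtain z where "poly (F d) z = 0" "poly (pderiv (F d)) z = 0"
      by (auto simp: rsquarefree_roots)
    then have z: "g d z = 0"
      by (simp add: g_def)
    obtain R :: nat where R: "norm z < real R"
      using reals_Archimedean2 by blast
    have "\<exists>x\<in>D. norm x < real R \<and> g d x < inverse (real (Suc k))" for k
    proof -
      have "open ({x. norm x < real R} \<inter> {x. g d x < inverse (real (Suc k))})"
        by (intro open_Int open_Collect_less continuous_intros cont)
      moreover have "z \<in> {x. norm x < real R} \<inter> {x. g d x < inverse (real (Suc k))}"
        using R z by simp
      ultimately show ?thesis
        using dense by blast
    qed
    then show "\<exists>R::nat. \<forall>k::nat. \<exists>x\<in>D. norm x < real R \<and> g d x < inverse (real (Suc k))"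
      by blast
  next
    assume "\<exists>R::nat. \<forall>k::nat. \<exists>x\<in>D. norm x < real R \<and> g d x < inverse (real (Suc k))"
    then obtain R :: nat
      where R: "\<And>k. \<exists>x\<in>D. norm x < real R \<and> g d x < inverse (real (Suc k))" by blast
    \<comment> \<open>Since \<open>R\<close> is chosen before \<open>k\<close>, all approximate
      zeros lie in one compact ball. The minimum of \<open>g d\<close> there is below every 1/(k+1),
      hence 0.\<close>
    obtain z where z: "\<And>x. x \<in> cball 0 (real R) \<Longrightarrow> g d z \<le> g d x"
      using continuous_attains_inf[OF compact_cball _ continuous_on_subset[OF cont subset_UNIV],
          of 0 "real R" d]
      by force
    have "g d z \<le> 0"
    proof (rule ccontr)
      assume "\<not> g d z \<le> 0"
      then obtain k where k: "inverse (real (Suc k)) < g d z"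
        using reals_Archimedean[of "g d z"] by auto
      obtain x where "norm x < real R" "g d x < inverse (real (Suc k))"
        using R by blast
      with z[of x] k show False by simp
    qed
    moreover have "0 \<le> norm (poly (F d) z)" "0 \<le> norm (poly (pderiv (F d)) z)"
      by simp_all
    ultimately have "norm (poly (F d) z) = 0 \<and> norm (poly (pderiv (F d)) z) = 0"
      unfolding g_def by linarith
    then show "\<not> rsquarefree (F d)"
      by (auto simp: rsquarefree_roots)
  qed
  then have eq: "rsquarefree (F d) \<longleftrightarrow>
      \<not> (\<exists>R::nat. \<forall>k::nat. \<exists>x\<in>D. norm x < real R \<and> g d x < inverse (real (Suc k)))" for d
    by blast
  show ?thesis
    unfolding eq using D by measurable
qed

text \<open>Over a good point \<open>d\<close> of the first \<open>k\<close> coordinates the bad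
  values of the next one form a finite set, which is null because points are. Integrating the
  indicator of the bad set by Fubini gives 0.\<close>

lemma AE_PiM_lessThan_induct:
  fixes N :: "'a measure" and P :: "nat \<Rightarrow> (nat \<Rightarrow> 'a) \<Rightarrow> bool"
  assumes "sigma_finite_measure N"
    and null: "\<And>z. AE s in N. s \<noteq> z"
    and meas: "\<And>k. k \<le> n \<Longrightarrow> Measurable.pred (PiM {..<k} (\<lambda>_. N)) (P k)"
    and zero: "P 0 (\<lambda>_. undefined)"
    and step: "\<And>k d. k < n \<Longrightarrow> P k d \<Longrightarrow> finite {s. \<not> P (Suc k) (d(k := s))}"
  shows "AE d in PiM {..<n} (\<lambda>_. N). P n d"
proof -
  interpret sigma_finite_measure N by fact
  interpret product_sigma_finite "\<lambda>_::nat. N" ..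
  have "AE d in PiM {..<k} (\<lambda>_. N). P k d" if "k \<le> n" for k
    using that
  proof (induction k)
    case 0
    \<comment> \<open>The empty product has the single point
      \<open>\<lambda>_. undefined\<close>.\<close>
    show ?case by (rule AE_I2) (simp add: space_PiM_empty zero)
  next
    case (Suc k)
    let ?I = "\<lambda>d. indicator {d. \<not> P (Suc k) d} d :: ennreal"
    have [measurable]: "Measurable.pred (PiM (insert k {..<k}) (\<lambda>_. N)) (P (Suc k))"
      using meas[OF Suc.prems] by (simp add: lessThan_Suc)
    have I: "?I \<in> borel_measurable (PiM (insert k {..<k}) (\<lambda>_. N))"
      by measurable
    have "AE d in PiM {..<k} (\<lambda>_. N). (\<integral>\<^sup>+ s. ?I (d(k := s)) \<partial>N) = 0"
      using Suc.IH[OF Suc_leD[OF Suc.prems]]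
    proof eventually_elim
      case (elim d)
      then have fin: "finite {s. \<not> P (Suc k) (d(k := s))}"
        using step Suc.prems by auto
      have "AE s in N. \<forall>z\<in>{s. \<not> P (Suc k) (d(k := s))}. s \<noteq> z"
        using fin null by (subst AE_finite_all) auto
      then have "AE s in N. P (Suc k) (d(k := s))"
        by eventually_elim auto
      then have "(\<integral>\<^sup>+ s. ?I (d(k := s)) \<partial>N) = (\<integral>\<^sup>+ s. 0 \<partial>N)"
        by (intro nn_integral_cong_AE) auto
      then show ?case by simp
    qed
    then have "(\<integral>\<^sup>+ d. \<integral>\<^sup>+ s. ?I (d(k := s)) \<partial>N \<partial>PiM {..<k} (\<lambda>_. N)) =
        (\<integral>\<^sup>+ d. 0 \<partial>PiM {..<k} (\<lambda>_. N))"
      by (rule nn_integral_cong_AE)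
    then have "(\<integral>\<^sup>+ d. ?I d \<partial>PiM (insert k {..<k}) (\<lambda>_. N)) = 0"
      by (subst product_nn_integral_insert[OF _ _ I]) simp_all
    then have "AE d in PiM (insert k {..<k}) (\<lambda>_. N). P (Suc k) d"
      by (subst AE_iff_nn_integral) simp_all
    then show ?case unfolding lessThan_Suc .
  qed
  then show ?thesis by simp
qed

section \<open>The reversed characteristic polynomial\<close>

text \<open>The matrix is \<open>1 - x M diag(d)\<close>.\<close>
definition rev_char_poly :: "nat \<Rightarrow> 'a::comm_ring_1 mat \<Rightarrow> (nat \<Rightarrow> 'a) \<Rightarrow> 'a poly" where
  "rev_char_poly n M d =
     Determinant.det (Matrix.mat n n (\<lambda>(i, j). [:if i = j then 1 else 0, - (M $$ (i, j) * d j):]))"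

lemma poly_rev_char_poly:
  "poly (rev_char_poly n M d) x =
     Determinant.det (Matrix.mat n n (\<lambda>(i, j). (if i = j then 1 else 0) - x * (M $$ (i, j) * d j)))"
  unfolding rev_char_poly_def by (rule poly_det_cong[of _ n]) auto

lemma rev_char_poly_zero: "rev_char_poly n M (\<lambda>_. 0) = 1"
proof -
  have "Matrix.mat n n (\<lambda>(i, j). [:if i = j then 1 else 0, - (M $$ (i, j) * 0):]) = 1\<^sub>m n"
    by (auto simp: Matrix.one_mat_def one_pCons intro!: eq_matI)
  then show ?thesis by (simp add: rev_char_poly_def)
qed

lemma rev_char_poly_cong:
  "(\<And>i. i < n \<Longrightarrow> d i = d' i) \<Longrightarrow> rev_char_poly n M d = rev_char_poly n M d'"
  unfolding rev_char_poly_def by (intro arg_cong[where f = Determinant.det] eq_matI) auto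

text \<open>The variable \<open>d k\<close> occurs only in column \<open>k\<close>, and there
  linearly. Expand along that column: the cofactors delete it and so do not involve
  \<open>d k\<close>.\<close>

lemma rev_char_poly_affine:
  assumes "k < n"
  shows "\<exists>B. \<forall>s. rev_char_poly n M (d(k := s)) = rev_char_poly n M (d(k := 0)) + Polynomial.smult s B"
proof -
  define A where
    "A s = Matrix.mat n n (\<lambda>(i, j). [:if i = j then 1 else 0, - (M $$ (i, j) * (d(k := s)) j):])"
    for s
  have cof: "cofactor (A s) i k = cofactor (A 0) i k" if "i < n" for i s
    using that assms unfolding cofactor_def mat_delete_def A_def
    by (intro arg_cong[where f = "\<lambda>B. (-1) ^ (i + k) * Determinant.det B"] eq_matI)
      (auto simp: less_diff_conv)
  have expand: "rev_char_poly n M (d(k := s)) =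
      (\<Sum>i<n. [:if i = k then 1 else 0, - (M $$ (i, k) * s):] * cofactor (A 0) i k)" for s
  proof -
    have "rev_char_poly n M (d(k := s)) = (\<Sum>i<n. A s $$ (i, k) * cofactor (A s) i k)"
      unfolding rev_char_poly_def A_def[symmetric]
      by (rule laplace_expansion_column) (use assms in \<open>auto simp: A_def\<close>)
    also have "\<dots> = (\<Sum>i<n. [:if i = k then 1 else 0, - (M $$ (i, k) * s):] * cofactor (A 0) i k)"
    proof (rule sum.cong[OF refl])
      fix i assume "i \<in> {..<n}"
      then have "i < n" by simp
      moreover have "A s $$ (i, k) = [:if i = k then 1 else 0, - (M $$ (i, k) * s):]"
        using \<open>i < n\<close> assms by (simp add: A_def)
      ultimately show "A s $$ (i, k) * cofactor (A s) i k =
          [:if i = k then 1 else 0, - (M $$ (i, k) * s):] * cofactor (A 0) i k"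
        using cof[of i s] by (simp only:)
    qed
    finally show ?thesis .
  qed
  show ?thesis
  proof (intro exI allI)
    fix s
    show "rev_char_poly n M (d(k := s)) = rev_char_poly n M (d(k := 0)) +
        Polynomial.smult s (\<Sum>i<n. [:0, - M $$ (i, k):] * cofactor (A 0) i k)"
      unfolding expand smult_sum2 sum.distrib[symmetric]
      by (intro sum.cong refl) (simp add: mult.commute flip: mult_smult_left distrib_right)
  qed
qed


text \<open>For nonzero \<open>x\<close>, det(1 - xA) = x^n det(1/x - A). At 0 the left side is det
  1 and the right side is the leading coefficient of a monic polynomial.\<close>

lemma rev_char_poly_eq_reflect_poly:
  fixes M :: "'a::field_char_0 mat"
  assumes M: "M \<in> carrier_mat n n"
  shows "rev_char_poly n M d = reflect_poly (char_poly (M * mat_diag n d))"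
proof -
  define A where "A = M * mat_diag n d"
  have A: "A \<in> carrier_mat n n" and A_index: "\<And>i j. i < n \<Longrightarrow> j < n \<Longrightarrow> A $$ (i, j) = M $$ (i, j) * d j"
    using M by (simp_all add: A_def mat_diag_mult_right[OF M])
  have deg: "Polynomial.degree (char_poly A) = n" and lead: "lead_coeff (char_poly A) = 1"
    using degree_monic_char_poly[OF A] by auto
  have "poly (rev_char_poly n M d) x = poly (reflect_poly (char_poly A)) x" for x
  proof (cases "x = 0")
    case True
    have "Matrix.mat n n (\<lambda>(i, j). if i = j then 1 else 0 :: 'a) = 1\<^sub>m n"
      by (simp add: Matrix.one_mat_def)
    then show ?thesis using True lead by (simp add: poly_rev_char_poly)
  next
    case False
    have "Matrix.mat n n (\<lambda>(i, j). (if i = j then 1 else 0) - x * (M $$ (i, j) * d j)) =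
        x \<cdot>\<^sub>m (- char_matrix A (inverse x))"
      using A A_index False by (intro eq_matI) (auto simp: char_matrix_def algebra_simps)
    moreover have "dim_col (- char_matrix A (inverse x)) = n"
      using A by (simp add: char_matrix_def)
    ultimately have "poly (rev_char_poly n M d) x = x ^ n * poly (char_poly A) (inverse x)"
      by (simp add: poly_rev_char_poly char_poly_matrix[OF A])
    then show ?thesis using False deg by (simp add: poly_reflect_poly_nz)
  qed
  then show ?thesis by (simp add: A_def poly_eq_poly_eq_iff[symmetric] fun_eq_iff)
qed

lemma distinct_eigenvalues_if_rsquarefree_rev_char_poly:
  fixes M :: "complex mat"
  assumes M: "M \<in> carrier_mat n n" and "Determinant.det M \<noteq> 0" and "\<And>i. i < n \<Longrightarrow> d i \<noteq> 0"
    and sf: "rsquarefree (rev_char_poly n M d)"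
  shows "distinct_eigenvalues (M * mat_diag n d)"
proof -
  define A where "A = M * mat_diag n d"
  define p where "p = char_poly A"
  have A: "A \<in> carrier_mat n n" using M by (simp add: A_def)
  have "Determinant.det (mat_diag n d) = (\<Prod>i = 0..<n. d i)"
    by (subst det_upper_triangular[of _ n])
      (auto simp: mat_diag_def upper_triangular_def prod_list_diag_prod)
  then have "Determinant.det A \<noteq> 0"
    using assms by (simp add: A_def det_mult[of _ n])
  moreover have "char_matrix A 0 = A"
    using A by (intro eq_matI) (auto simp: char_matrix_def)
  ultimately have p0: "poly p 0 \<noteq> 0"
    using eigenvalue_root_char_poly[OF A, of 0] eigenvalue_det[OF A, of 0] by (simp add: p_def)
  have rev: "rev_char_poly n M d = reflect_poly p"
    using rev_char_poly_eq_reflect_poly[OF M] by (simp add: p_def A_def)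
  have "bij_betw inverse {z. poly p z = 0} {z. poly (reflect_poly p) z = 0}"
  proof (rule bij_betw_byWitness[where f' = inverse])
    show "inverse ` {z. poly p z = 0} \<subseteq> {z. poly (reflect_poly p) z = 0}"
    proof clarify
      fix z assume z: "poly p z = 0"
      then have "z \<noteq> 0" using p0 by auto
      with z show "poly (reflect_poly p) (inverse z) = 0" by (simp add: poly_reflect_poly_nz)
    qed
    show "inverse ` {z. poly (reflect_poly p) z = 0} \<subseteq> {z. poly p z = 0}"
    proof clarify
      fix z assume z: "poly (reflect_poly p) z = 0"
      \<comment> \<open>At 0 the reflected polynomial takes the leading coefficient of
        \<open>p\<close>, which is nonzero.\<close>
      have "z \<noteq> 0" using z p0 by auto
      with z show "poly p (inverse z) = 0" by (simp add: poly_reflect_poly_nz)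
    qed
  qed auto
  then have "card {z. poly p z = 0} = card {z. poly (reflect_poly p) z = 0}"
    by (rule bij_betw_same_card)
  also have "\<dots> = Polynomial.degree (reflect_poly p)"
    using sf rev by (simp add: card_roots_rsquarefree)
  also have "\<dots> = n"
    using p0 degree_monic_char_poly[OF A] by (simp add: p_def poly_0_coeff_0)
  finally show ?thesis
    using A by (simp add: distinct_eigenvalues_def p_def flip: A_def)
qed

section \<open>Almost every diagonal factor, for both measures\<close>

lemma AE_distinct_eigenvalues:
  fixes N :: "complex measure"
  assumes M: "M \<in> carrier_mat n n" and inv: "invertible_mat M"
    and "sigma_finite_measure N" and null: "\<And>z. AE s in N. s \<noteq> z"
    and N[measurable]: "(\<lambda>s. s) \<in> borel_measurable N"
  shows "AE d in PiM {..<n} (\<lambda>_. N). distinct_eigenvalues (M * mat_diag n d)"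
proof -
  \<comment> \<open>Coordinates not yet switched on are set to 0, replacing the value
    \<open>undefined\<close> that points of the partial product have there.\<close>
  define e :: "nat \<Rightarrow> (nat \<Rightarrow> complex) \<Rightarrow> nat \<Rightarrow> complex"
    where "e k d = (\<lambda>i. if i < k then d i else 0)" for k d
  define P where "P k d \<longleftrightarrow> (\<forall>i<k. d i \<noteq> 0) \<and> rsquarefree (rev_char_poly n M (e k d))" for k d
  have P: "AE d in PiM {..<n} (\<lambda>_. N). P n d"
  proof (rule AE_PiM_lessThan_induct)
    fix k assume "k \<le> n"
    have comp: "(\<lambda>d. d i) \<in> borel_measurable (PiM {..<k} (\<lambda>_. N))" if "i < k" for i
      by (rule measurable_compose[OF _ N]) (simp add: that)
    have [measurable]: "(\<lambda>d. e k d i) \<in> borel_measurable (PiM {..<k} (\<lambda>_. N))" for i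
      by (cases "i < k") (simp_all add: e_def comp)
    have [measurable]: "Measurable.pred (PiM {..<k} (\<lambda>_. N)) (\<lambda>d. rsquarefree (rev_char_poly n M (e k d)))"
    proof (rule pred_rsquarefree)
      fix x
      \<comment> \<open>The Leibniz formula shows the value at \<open>x\<close> to be a polynomial
        in the coordinates, hence measurable.\<close>
      have "poly (rev_char_poly n M (e k d)) x =
          (\<Sum>p | p permutes {0..<n}. signof p *
            (\<Prod>i = 0..<n. (if i = p i then 1 else 0) - x * (M $$ (i, p i) * e k d (p i))))" for d
        unfolding poly_rev_char_poly
        by (subst det_def'[of _ n]) (auto intro!: sum.cong prod.cong simp: permutes_in_image)
      then show "(\<lambda>d. poly (rev_char_poly n M (e k d)) x) \<in> borel_measurable (PiM {..<k} (\<lambda>_. N))"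
        by simp
    qed
    have "P k = (\<lambda>d. (\<forall>i\<in>{..<k}. e k d i \<noteq> 0) \<and> rsquarefree (rev_char_poly n M (e k d)))"
      by (auto simp: P_def e_def fun_eq_iff)
    then show "Measurable.pred (PiM {..<k} (\<lambda>_. N)) (P k)"
      by simp
  next
    have "e 0 d = (\<lambda>_. 0)" for d by (simp add: e_def)
    then show "P 0 (\<lambda>_. undefined)"
      by (simp add: P_def rev_char_poly_zero rsquarefree_roots)
  next
    fix k d assume "k < n" "P k d"
    have e_upd: "e (Suc k) (d(k := s)) = (e k d)(k := s)" and e_0: "(e k d)(k := 0) = e k d" for s
      by (auto simp: e_def fun_eq_iff less_Suc_eq)
    obtain B where B: "\<And>s. rev_char_poly n M ((e k d)(k := s)) =
        rev_char_poly n M (e k d) + Polynomial.smult s B"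
      using rev_char_poly_affine[OF \<open>k < n\<close>, of M "e k d"] by (auto simp: e_0)
    \<comment> \<open>The value 0 is excluded to keep the diagonal factor invertible; the pencil
      lemma bounds the other bad values.\<close>
    have "{s. \<not> P (Suc k) (d(k := s))} \<subseteq>
        insert 0 {s. \<not> rsquarefree (rev_char_poly n M (e k d) + Polynomial.smult s B)}"
      using \<open>P k d\<close> by (auto simp: P_def e_upd B less_Suc_eq)
    moreover have "finite {s. \<not> rsquarefree (rev_char_poly n M (e k d) + Polynomial.smult s B)}"
      using \<open>P k d\<close> by (intro finite_not_rsquarefree_pencil) (simp add: P_def)
    ultimately show "finite {s. \<not> P (Suc k) (d(k := s))}"
      using finite_subset by blast
  qed fact+
  have det: "Determinant.det M \<noteq> 0"
  proof -
    obtain B where B: "M * B = 1\<^sub>m (dim_row M)" "B * M = 1\<^sub>m (dim_row B)"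
      using inv by (auto simp: invertible_mat_def inverts_mat_def)
    have "dim_col B = n" "dim_row B = n"
      using M arg_cong[OF B(1), of dim_col] arg_cong[OF B(2), of dim_col] by simp_all
    then have "Determinant.det M * Determinant.det B = 1"
      using B(1) M det_mult[of M n B] by auto
    then show ?thesis by auto
  qed
  from P show ?thesis
  proof eventually_elim
    case (elim d)
    have "rev_char_poly n M (e n d) = rev_char_poly n M d"
      by (rule rev_char_poly_cong) (simp add: e_def)
    with elim det show ?case
      by (intro distinct_eigenvalues_if_rsquarefree_rev_char_poly M) (auto simp: P_def)
  qed
qed

text \<open>On the half-open interval [0, 2 pi) \<open>cis\<close> is injective, so the preimage of
  a point is at most one angle, a Lebesgue null set.\<close>

lemma AE_circle_measure_neq: "AE s in circle_measure. s \<noteq> z"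
proof -
  have "{t \<in> {0..<2 * pi}. cis t = z} \<subseteq> {Arg2pi z}"
    using Arg2pi_unique[of 1] by (auto simp: cis_conv_exp)
  then have fin: "finite {t \<in> {0..<2 * pi}. cis t = z}"
    by (rule finite_subset) simp
  have "AE t in lborel. \<forall>u\<in>{t \<in> {0..<2 * pi}. cis t = z}. t \<noteq> u"
    using fin by (subst AE_finite_all) (auto intro: AE_lborel_singleton)
  then have "AE t in uniform_measure lborel {0..<2 * pi}. cis t \<noteq> z"
    by (intro AE_uniform_measureI) auto
  moreover have "{s \<in> space (restrict_space borel (sphere 0 1)). s \<noteq> z}
      \<in> sets (restrict_space borel (sphere 0 1))"
    by (auto simp: space_restrict_space sets_restrict_space_iff)
  ultimately show ?thesis
    unfolding circle_measure_def by (subst AE_distr_iff[OF cis_measurable_circle])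
qed

theorem theorem1p4:
  fixes M :: "complex mat" and n :: nat
  assumes "M \<in> carrier_mat n n"
    and "invertible_mat M"
  shows "(AE d in lebesgue_Cn n. distinct_eigenvalues (M * mat_diag n d)) \<and>
         (AE \<omega> in torus_measure n. distinct_eigenvalues (M * mat_diag n \<omega>))"
proof
  show "AE d in lebesgue_Cn n. distinct_eigenvalues (M * mat_diag n d)"
    unfolding lebesgue_Cn_def using assms
    by (intro AE_distinct_eigenvalues) (auto intro: AE_lborel_singleton sigma_finite_lborel)
  have "sigma_finite_measure circle_measure"
    using prob_space_circle_measure by (simp add: prob_space_imp_sigma_finite)
  moreover have "(\<lambda>s. s) \<in> borel_measurable circle_measure"
    unfolding circle_measure_def by (simp add: measurable_restrict_space1)
  ultimately show "AE \<omega> in torus_measure n. distinct_eigenvalues (M * mat_diag n \<omega>)"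
    unfolding torus_measure_def using assms
    by (intro AE_distinct_eigenvalues AE_circle_measure_neq)
qed

end
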